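(* Let $0<\varepsilon<1$, $0<\delta<1$, $\zeta>0$ and $\rho>0$. Define $\nu=\dfrac{\varepsilon}{(1+\varepsilon)\ln(1+\varepsilon)-\varepsilon}$ and $\tau=\left\lceil\dfrac{\ln(1+\nu)}{\ln(1+\rho)}\right\rceil$. Let $\gamma_1<\gamma_2<\cdots<\gamma_s$ be the ascending arrangement of all distinct elements of $$\left\{\left\lceil(1+\nu)^{\frac{i}{\tau}}\,\frac{\ln\frac{1}{\zeta\delta}}{\ln(1+\varepsilon)}\right\rceil : i=0,1,\ldots,\tau\right\}.$$ Let $p\in(0,1)$ and let $X_1,X_2,\ldots$ be i.i.d. Bernoulli random variables with $\Pr\{X_i=1\}=1-\Pr\{X_i=0\}=p$. For $\ell=1,\ldots,s$, let $\widehat{p}_\ell=\frac{\gamma_\ell}{\mathbf n_\ell}$, where $\mathbf n_\ell$ is the minimum number of samples such that $\sum_{i=1}^{\mathbf n_\ell}X_i=\gamma_\ell$. Suppose sampling is continued until $S_{\mathrm B}\left(\gamma_\ell,\mathbf n_\ell,\mathbf n_\ell,\frac{\widehat{p}_\ell}{1+\varepsilon}\right)\le\zeta\delta$ and $S_{\mathrm B}\left(0,\gamma_\ell,\mathbf n_\ell,\frac{\widehat{p}_\ell}{1-\varepsilon}\right)\le\zeta\delta$ for some $\ell\in\{1,\ldots,s\}$. Let $\widehat{p}=\frac{\sum_{i=1}^{\mathbf n}X_i}{\mathbf n}$, where $\mathbf n$ is the sample size when the sampling is terminated. Then $\Pr\left\{\left|\frac{\widehat{p}-p}{p}\right|<\varepsilon\right\}\ge1-\delta$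 for every $p\in(0,1)$, provided that $0<\zeta\le\frac{1}{2(\tau+1)}$.
   Context: For integers $0\le k\le l\le n$ and real $p$, $S_{\mathrm B}(k,l,n,p)=\sum_{i=k}^{l}\binom{n}{i}p^i(1-p)^{n-i}$ if $p\in(0,1)$, and $S_{\mathrm B}(k,l,n,p)=0$ if $p\notin(0,1)$. The sampling proceeds through stages $\ell=1,2,\ldots,s$, where at stage $\ell$ samples have been observed until their sum reaches $\gamma_\ell$ (inverse sampling), so $\mathbf n_\ell$ is random; the sampling terminates at the first stage $\ell$ at which the stopping condition holds, and then $\mathbf n=\mathbf n_\ell$ and $\widehat{p}=\widehat{p}_\ell$. *)

theory Defs
  imports "HOL-Probability.Probability" "HOL-Library.Extended_Nat"
begin

definition S_B :: "nat \<Rightarrow> nat \<Rightarrow> nat \<Rightarrow> real \<Rightarrow> real" where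
  "S_B k l n p =
     (if p \<in> {0<..<1} then \<Sum>i=k..l. real (n choose i) * p ^ i * (1 - p) ^ (n - i) else 0)"

text \<open>Inverse sampling: the least number of samples whose sum equals \<open>g\<close>; it is
  \<open>\<infinity>\<close> on outcomes where the partial sums never attain \<open>g\<close>.\<close>

definition inv_sample_number :: "(nat \<Rightarrow> 'a \<Rightarrow> real) \<Rightarrow> nat \<Rightarrow> 'a \<Rightarrow> enat" where
  "inv_sample_number X g \<omega> = (INF n\<in>{n. (\<Sum>i=1..n. X i \<omega>) = real g}. enat n)"

text \<open>The stopping test at a stage with sum threshold \<open>g\<close> and \<open>n\<close> samples, where the
  estimate of that stage is \<open>g / n\<close> and \<open>\<eta>\<close> is the confidence level \<open>\<zeta> \<delta>\<close>.\<close>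

definition stopping_test :: "real \<Rightarrow> real \<Rightarrow> nat \<Rightarrow> nat \<Rightarrow> bool" where
  "stopping_test \<epsilon> \<eta> g n \<longleftrightarrow>
     (let ph = real g / real n in
        S_B g n n (ph / (1 + \<epsilon>)) \<le> \<eta> \<and> S_B 0 g n (ph / (1 - \<epsilon>)) \<le> \<eta>)"

text \<open>A stage whose threshold is never attained is never completed, so it cannot satisfy
  the stopping condition.\<close>

definition stops_at ::
  "real \<Rightarrow> real \<Rightarrow> (nat \<Rightarrow> nat) \<Rightarrow> (nat \<Rightarrow> 'a \<Rightarrow> real) \<Rightarrow> 'a \<Rightarrow> nat \<Rightarrow> bool" where
  "stops_at \<epsilon> \<eta> \<gamma> X \<omega> l \<longleftrightarrow>
     (\<exists>n. inv_sample_number X (\<gamma> l) \<omega> = enat n \<and> stopping_test \<epsilon> \<eta> (\<gamma> l) n)"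

definition terminates ::
  "real \<Rightarrow> real \<Rightarrow> nat \<Rightarrow> (nat \<Rightarrow> nat) \<Rightarrow> (nat \<Rightarrow> 'a \<Rightarrow> real) \<Rightarrow> 'a \<Rightarrow> bool" where
  "terminates \<epsilon> \<eta> s \<gamma> X \<omega> \<longleftrightarrow> (\<exists>l\<in>{1..s}. stops_at \<epsilon> \<eta> \<gamma> X \<omega> l)"

text \<open>The next three are meaningful only on outcomes where the sampling terminates.\<close>

definition stopping_stage ::
  "real \<Rightarrow> real \<Rightarrow> nat \<Rightarrow> (nat \<Rightarrow> nat) \<Rightarrow> (nat \<Rightarrow> 'a \<Rightarrow> real) \<Rightarrow> 'a \<Rightarrow> nat" where
  "stopping_stage \<epsilon> \<eta> s \<gamma> X \<omega> = (LEAST l. l \<in> {1..s} \<and> stops_at \<epsilon> \<eta> \<gamma> X \<omega> l)"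

definition sample_size ::
  "real \<Rightarrow> real \<Rightarrow> nat \<Rightarrow> (nat \<Rightarrow> nat) \<Rightarrow> (nat \<Rightarrow> 'a \<Rightarrow> real) \<Rightarrow> 'a \<Rightarrow> nat" where
  "sample_size \<epsilon> \<eta> s \<gamma> X \<omega> =
     the_enat (inv_sample_number X (\<gamma> (stopping_stage \<epsilon> \<eta> s \<gamma> X \<omega>)) \<omega>)"

definition p_hat ::
  "real \<Rightarrow> real \<Rightarrow> nat \<Rightarrow> (nat \<Rightarrow> nat) \<Rightarrow> (nat \<Rightarrow> 'a \<Rightarrow> real) \<Rightarrow> 'a \<Rightarrow> real" where
  "p_hat \<epsilon> \<eta> s \<gamma> X \<omega> =
     (\<Sum>i=1..sample_size \<epsilon> \<eta> s \<gamma> X \<omega>. X i \<omega>) / real (sample_size \<epsilon> \<eta> s \<gamma> X \<omega>)"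

end

theory Submission
  imports Defs
begin

text \<open>
  Write \<open>N\<close> for the number of samples needed to reach the threshold \<open>g\<close>, and suppose a stage stops
  with an estimate \<open>g / N\<close> outside the tolerance. Since binomial tails are monotone in the success
  probability, the stopping test then holds with \<open>p\<close> itself in place of the perturbed estimate: either
  \<open>P(Bin(N, p) \<ge> g) \<le> \<eta>\<close> or \<open>P(Bin(N, p) \<le> g) \<le> \<eta>\<close>, where \<open>\<eta> = \<zeta> \<delta>\<close>. As \<open>P(Bin(n, p) \<ge> g) = P(N \<le> n)\<close> and
  \<open>P(Bin(n, p) \<le> g) \<ge> P(N \<ge> n)\<close>, each alternative has probability at most \<open>\<eta>\<close>, and there are at most
  \<open>\<tau> + 1\<close> stages. The choice of \<open>\<nu>\<close> makes the last threshold so large that the Chernoff bounds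
  force the last stage to pass the test whenever it is reached, which happens almost surely.
\<close>

subsection \<open>Binomial tails\<close>

text \<open>The upper tail P(Bin(n, p) \<ge> k). Unlike \<open>S_B\<close> it has no cutoff outside
  the open unit interval, so the recursion in \<open>n\<close> and \<open>k\<close> holds for every
  \<open>p\<close>; the empty sum makes it 0 for \<open>k > n\<close>.\<close>

definition binomial_tail :: "real \<Rightarrow> nat \<Rightarrow> nat \<Rightarrow> real" where
  "binomial_tail p n k = (\<Sum>i=k..n. real (n choose i) * p ^ i * (1 - p) ^ (n - i))"

lemma binomial_tail_0 [simp]: "binomial_tail p n 0 = 1"
  using binomial_ring[of p "1 - p" n] by (simp add: binomial_tail_def atMost_atLeast0)

lemma binomial_tail_0_Suc [simp]: "binomial_tail p 0 (Suc k) = 0"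
  by (simp add: binomial_tail_def)

text \<open>Conditioning on one trial; algebraically, Pascal's rule term by term.\<close>

lemma binomial_tail_Suc_Suc:
  "binomial_tail p (Suc n) (Suc k) = p * binomial_tail p n k + (1 - p) * binomial_tail p n (Suc k)"
proof -
  define f where "f i = real (n choose i) * p ^ i * (1 - p) ^ (n - i)" for i
  have split: "real (Suc n choose Suc i) * p ^ Suc i * (1 - p) ^ (Suc n - Suc i)
      = p * f i + (1 - p) * f (Suc i)" if "i \<le> n" for i
  \<comment> \<open>At \<open>i = n\<close> the exponent \<open>n - Suc i\<close> is truncated, but
    \<open>f (Suc i)\<close> vanishes through its binomial coefficient.\<close>
  proof (cases "i = n")
    case False
    then have "(1 - p) ^ (n - i) = (1 - p) * (1 - p) ^ (n - Suc i)"
      using that by (metis Suc_diff_Suc le_neq_implies_less power_Suc)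
    then show ?thesis unfolding f_def diff_Suc_Suc by (simp only:) (simp add: algebra_simps)
  qed (simp add: f_def)
  have "binomial_tail p (Suc n) (Suc k) = (\<Sum>i=k..n. p * f i + (1 - p) * f (Suc i))"
    unfolding binomial_tail_def sum.shift_bounds_cl_Suc_ivl
    using split by (intro sum.cong) auto
  also have "\<dots> = p * (\<Sum>i=k..n. f i) + (1 - p) * (\<Sum>i=Suc k..Suc n. f i)"
    by (simp add: sum.distrib sum_distrib_left sum.shift_bounds_cl_Suc_ivl del: sum.cl_ivl_Suc)
  also have "(\<Sum>i=Suc k..Suc n. f i) = (\<Sum>i=Suc k..n. f i)"
    by (simp add: f_def)
  finally show ?thesis by (simp add: binomial_tail_def f_def)
qed

lemma binomial_tail_Suc_le:
  assumes "0 \<le> p" "p \<le> 1"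
  shows "binomial_tail p n (Suc k) \<le> binomial_tail p n k"
  unfolding binomial_tail_def using assms by (intro sum_mono2) auto

text \<open>One further trial adds at most one success. This supplies the index shift in
  \<open>underestimation_event\<close>.\<close>

lemma binomial_tail_Suc_Suc_le:
  assumes "0 \<le> p" "p \<le> 1"
  shows "binomial_tail p (Suc n) (Suc k) \<le> binomial_tail p n k"
proof -
  have "(1 - p) * binomial_tail p n (Suc k) \<le> (1 - p) * binomial_tail p n k"
    using assms binomial_tail_Suc_le by (intro mult_left_mono) auto
  then show ?thesis by (simp add: binomial_tail_Suc_Suc algebra_simps)
qed

text \<open>By the recursion the tail is a weighted mean of two shorter tails, and a larger success
  probability moves weight to the larger of the two.\<close>

lemma binomial_tail_mono_prob:
  assumes "0 \<le> p" "p \<le> q" "q \<le> 1"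
  shows "binomial_tail p n k \<le> binomial_tail q n k"
proof (induction n arbitrary: k)
  case 0
  then show ?case by (cases k) auto
next
  case (Suc n)
  show ?case
  proof (cases k)
    case (Suc j)
    have "binomial_tail p (Suc n) (Suc j) \<le> p * binomial_tail q n j + (1 - p) * binomial_tail q n (Suc j)"
      unfolding binomial_tail_Suc_Suc using assms Suc.IH
      by (intro add_mono mult_left_mono) auto
    also have "\<dots> = binomial_tail q n (Suc j) + p * (binomial_tail q n j - binomial_tail q n (Suc j))"
      by (simp add: algebra_simps)
    also have "\<dots> \<le> binomial_tail q n (Suc j) + q * (binomial_tail q n j - binomial_tail q n (Suc j))"
      using assms binomial_tail_Suc_le[of q n j] by (intro add_left_mono mult_right_mono) auto
    also have "\<dots> = binomial_tail q (Suc n) (Suc j)"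
      by (simp add: binomial_tail_Suc_Suc algebra_simps)
    finally show ?thesis using Suc by simp
  qed simp
qed

lemma S_B_upper: "0 < p \<Longrightarrow> p < 1 \<Longrightarrow> S_B k n n p = binomial_tail p n k"
  by (simp add: S_B_def binomial_tail_def)

lemma binomial_tail_compl:
  "1 - binomial_tail p n (Suc k) = (\<Sum>i\<in>{..n} \<inter> {..k}. real (n choose i) * p ^ i * (1 - p) ^ (n - i))"
proof -
  let ?f = "\<lambda>i. real (n choose i) * p ^ i * (1 - p) ^ (n - i)"
  have "1 = sum ?f {..n}"
    using binomial_ring[of p "1 - p" n] by simp
  also have "{..n} = ({..n} \<inter> {..k}) \<union> {Suc k..n}" by auto
  also have "sum ?f \<dots> = sum ?f ({..n} \<inter> {..k}) + sum ?f {Suc k..n}"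
    by (rule sum.union_disjoint) auto
  finally show ?thesis by (simp add: binomial_tail_def)
qed

lemma S_B_lower:
  assumes "0 < p" "p < 1" "g \<le> n"
  shows "S_B 0 g n p = 1 - binomial_tail p n (Suc g)"
proof -
  have "{..n} \<inter> {..g} = {0..g}" using assms by auto
  then show ?thesis using assms by (simp add: S_B_def binomial_tail_compl)
qed

section \<open>Chernoff bounds for binomial tails\<close>

lemma binomial_generating_function:
  "(\<Sum>i\<le>n. real (n choose i) * p ^ i * (1 - p) ^ (n - i) * x ^ i) = (1 + (x - 1) * p) ^ n"
  using binomial_ring[of "x * p" "1 - p" n] by (simp add: power_mult_distrib algebra_simps)

text \<open>Markov's inequality for x to the power of a binomial variable, whose mean is the
  generating function.\<close>

lemma binomial_tail_le_chernoff:
  assumes "0 \<le> p" "p \<le> 1" "1 \<le> x"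
  shows "binomial_tail p n k \<le> (1 + (x - 1) * p) ^ n / x ^ k"
proof -
  let ?f = "\<lambda>i. real (n choose i) * p ^ i * (1 - p) ^ (n - i)"
  have "binomial_tail p n k * x ^ k = (\<Sum>i=k..n. ?f i * x ^ k)"
    by (simp add: binomial_tail_def sum_distrib_right)
  also have "\<dots> \<le> (\<Sum>i=k..n. ?f i * x ^ i)"
    using assms by (intro sum_mono mult_left_mono power_increasing) auto
  also have "\<dots> \<le> (\<Sum>i\<le>n. ?f i * x ^ i)"
    using assms by (intro sum_mono2) auto
  finally show ?thesis
    unfolding binomial_generating_function using assms by (simp add: pos_le_divide_eq)
qed

text \<open>The same argument with \<open>x \<le> 1\<close>, where \<open>x ^ k\<close> is the
  smallest weight among the indices up to \<open>k\<close>.\<close>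

lemma binomial_tail_compl_le_chernoff:
  assumes "0 \<le> p" "p \<le> 1" "0 < x" "x \<le> 1"
  shows "1 - binomial_tail p n (Suc k) \<le> (1 + (x - 1) * p) ^ n / x ^ k"
proof -
  let ?f = "\<lambda>i. real (n choose i) * p ^ i * (1 - p) ^ (n - i)"
  have "(1 - binomial_tail p n (Suc k)) * x ^ k = (\<Sum>i\<in>{..n} \<inter> {..k}. ?f i * x ^ k)"
    by (simp add: binomial_tail_compl sum_distrib_right)
  also have "\<dots> \<le> (\<Sum>i\<in>{..n} \<inter> {..k}. ?f i * x ^ i)"
    using assms by (intro sum_mono mult_left_mono power_decreasing) auto
  also have "\<dots> \<le> (\<Sum>i\<le>n. ?f i * x ^ i)"
    using assms by (intro sum_mono2) auto
  finally show ?thesis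
    unfolding binomial_generating_function using assms by (simp add: pos_le_divide_eq)
qed

text \<open>For fixed positive \<open>k\<close>, the lower-tail bound at \<open>x = 1 / 2\<close>
  decays geometrically with ratio \<open>1 - p / 2\<close>.\<close>

lemma binomial_tail_tendsto_1:
  assumes "0 < p" "p < 1"
  shows "(\<lambda>n. binomial_tail p n k) \<longlonglongrightarrow> 1"
proof (cases k)
  case (Suc j)
  have "(\<lambda>n. 1 - (1 - p / 2) ^ n * 2 ^ j) \<longlonglongrightarrow> 1 - 0 * 2 ^ j"
    using assms by (intro tendsto_intros LIMSEQ_power_zero) auto
  moreover have "1 - (1 - p / 2) ^ n * 2 ^ j \<le> binomial_tail p n k" for n
  proof -
    have "1 + (1 / 2 - 1) * p = 1 - p / 2" by simp
    with binomial_tail_compl_le_chernoff[of p "1 / 2" n j] assms Suc show ?thesis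
      by (simp add: power_one_over field_simps)
  qed
  moreover have "binomial_tail p n k \<le> 1" for n
    using assms sum_nonneg[of "{..n} \<inter> {..j}" "\<lambda>i. real (n choose i) * p ^ i * (1 - p) ^ (n - i)"]
      Suc binomial_tail_compl[of p n j] by simp
  ultimately show ?thesis
    using tendsto_sandwich[of "\<lambda>n. 1 - (1 - p / 2) ^ n * 2 ^ j" "\<lambda>n. binomial_tail p n k" sequentially "\<lambda>_. 1" 1]
    by simp
qed simp

subsection \<open>The stopping test\<close>

lemma power_le_exp_mult:
  fixes y :: real
  assumes "0 \<le> 1 + y"
  shows "(1 + y) ^ n \<le> exp (real n * y)"
  unfolding exp_of_nat_mult using assms by (intro power_mono) auto

text \<open>The sides are the Chernoff exponents per success of the two halves of the stopping test,
  upper tail on the left. Hence a threshold large enough for the upper tail also serves the lower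
  tail. The difference vanishes at 0 and has nonnegative derivative.\<close>

lemma ln_ratio_bound:
  fixes \<epsilon> :: real
  assumes "0 \<le> \<epsilon>" "\<epsilon> < 1"
  shows "ln (1 + \<epsilon>) - \<epsilon> / (1 + \<epsilon>) \<le> \<epsilon> / (1 - \<epsilon>) + ln (1 - \<epsilon>)"
proof -
  let ?g = "\<lambda>x::real. x / (1 - x) + ln (1 - x) - ln (1 + x) + x / (1 + x)"
  have "?g 0 \<le> ?g \<epsilon>"
  proof (rule DERIV_nonneg_imp_nondecreasing[OF assms(1)])
    fix x :: real
    assume x: "0 \<le> x" "x \<le> \<epsilon>"
    have "(?g has_real_derivative (x / (1 - x)\<^sup>2 - x / (1 + x)\<^sup>2)) (at x)"
    proof -
      have "((\<lambda>x. x / (1 - x)) has_real_derivative 1 / (1 - x)\<^sup>2) (at x)"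
        using x assms by (auto intro!: derivative_eq_intros simp: power2_eq_square)
      moreover have "((\<lambda>x. x / (1 + x)) has_real_derivative 1 / (1 + x)\<^sup>2) (at x)"
        using x assms by (auto intro!: derivative_eq_intros simp: power2_eq_square)
      moreover have "((\<lambda>x. ln (1 - x)) has_real_derivative - 1 / (1 - x)) (at x)"
        using x assms by (auto intro!: derivative_eq_intros)
      moreover have "((\<lambda>x. ln (1 + x)) has_real_derivative 1 / (1 + x)) (at x)"
        using x assms by (auto intro!: derivative_eq_intros)
      ultimately have "(?g has_real_derivative
          1 / (1 - x)\<^sup>2 + - 1 / (1 - x) - 1 / (1 + x) + 1 / (1 + x)\<^sup>2) (at x)"
        by (intro DERIV_add DERIV_diff)
      moreover have "1 / (1 - x)\<^sup>2 + - 1 / (1 - x) - 1 / (1 + x) + 1 / (1 + x)\<^sup>2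
          = x / (1 - x)\<^sup>2 - x / (1 + x)\<^sup>2"
      proof -
        \<comment> \<open>Applied at \<open>1 - x\<close> and \<open>1 + x\<close>, this pairs the
          four terms of the derivative into two.\<close>
        have "1 / u\<^sup>2 - 1 / u = (1 - u) / u\<^sup>2" if "u \<noteq> 0" for u :: real
          using that by (simp add: power2_eq_square diff_divide_distrib)
        from this[of "1 - x"] this[of "1 + x"] show ?thesis using x assms by simp
      qed
      ultimately show ?thesis by simp
    qed
    moreover have "x / (1 + x)\<^sup>2 \<le> x / (1 - x)\<^sup>2"
      using x assms by (intro divide_left_mono power_mono mult_pos_pos) auto
    ultimately show "\<exists>y. (?g has_real_derivative y) (at x) \<and> 0 \<le> y" by force
  qed
  then show ?thesis by simp
qed

text \<open>From \<open>ln y < y - 1\<close> at \<open>y = 1 / (1 + \<epsilon>)\<close>, strict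
  because equality occurs only at 1. The quantity is the denominator of \<nu>, and
  \<open>1 + \<epsilon>\<close> times the upper-tail exponent per success.\<close>

lemma chernoff_rate_pos:
  fixes \<epsilon> :: real
  assumes "0 < \<epsilon>"
  shows "0 < (1 + \<epsilon>) * ln (1 + \<epsilon>) - \<epsilon>"
proof -
  have "ln (1 / (1 + \<epsilon>)) < 1 / (1 + \<epsilon>) - 1"
    using assms ln_le_minus_one[of "1 / (1 + \<epsilon>)"] ln_eq_minus_one[of "1 / (1 + \<epsilon>)"] by fastforce
  then have "(1 + \<epsilon>) * (1 - 1 / (1 + \<epsilon>)) < (1 + \<epsilon>) * ln (1 + \<epsilon>)"
    using assms by (intro mult_strict_left_mono) (auto simp: ln_div)
  moreover have "(1 + \<epsilon>) * (1 - 1 / (1 + \<epsilon>)) = \<epsilon>"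
    using assms by (simp add: field_simps)
  ultimately show ?thesis by simp
qed

text \<open>Chernoff bounds with \<open>x = 1 + \<epsilon>\<close> and
  \<open>x = 1 - \<epsilon>\<close> at the perturbed estimates, followed by
  \<open>1 + y \<le> exp y\<close>. Since n times the estimate is g, the sample size cancels and the
  bound depends on g alone.\<close>

lemma stopping_test_large_threshold:
  fixes \<epsilon> \<eta> :: real
  assumes eps: "0 < \<epsilon>" "\<epsilon> < 1" and eta: "0 < \<eta>" and g: "1 \<le> g" "g \<le> n"
    and large: "ln (1 / \<eta>) \<le> real g * (ln (1 + \<epsilon>) - \<epsilon> / (1 + \<epsilon>))"
  shows "stopping_test \<epsilon> \<eta> g n"
proof -
  define z where "z = real g / real n"
  have n: "0 < n" using g by simp
  have z: "0 < z" "z \<le> 1" using g n by (auto simp: z_def)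
  have rate: "exp (- (real g * (ln (1 + \<epsilon>) - \<epsilon> / (1 + \<epsilon>)))) \<le> \<eta>"
  proof -
    have "- (real g * (ln (1 + \<epsilon>) - \<epsilon> / (1 + \<epsilon>))) \<le> ln \<eta>"
      using large eta by (simp add: ln_div)
    then show ?thesis using eta by (simp add: ln_ge_iff)
  qed
  have "S_B g n n (z / (1 + \<epsilon>)) \<le> \<eta>"
  proof -
    let ?q = "z / (1 + \<epsilon>)"
    have q: "0 < ?q" "?q < 1" using z eps by auto
    have pos: "0 \<le> 1 + \<epsilon> * ?q" using eps q mult_nonneg_nonneg[of \<epsilon> ?q] by linarith
    have "S_B g n n ?q = binomial_tail ?q n g" by (rule S_B_upper[OF q])
    also have "\<dots> \<le> (1 + \<epsilon> * ?q) ^ n / (1 + \<epsilon>) ^ g"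
      using binomial_tail_le_chernoff[of ?q "1 + \<epsilon>" n g] q eps by simp
    also have "\<dots> \<le> exp (real n * (\<epsilon> * ?q)) / (1 + \<epsilon>) ^ g"
      using pos eps by (intro divide_right_mono power_le_exp_mult) auto
    also have "real n * (\<epsilon> * ?q) = real g * (\<epsilon> / (1 + \<epsilon>))"
      using n by (simp add: z_def)
    also have "(1 + \<epsilon>) ^ g = exp (real g * ln (1 + \<epsilon>))"
      using eps by (simp add: exp_of_nat_mult)
    also have "exp (real g * (\<epsilon> / (1 + \<epsilon>))) / exp (real g * ln (1 + \<epsilon>))
        = exp (- (real g * (ln (1 + \<epsilon>) - \<epsilon> / (1 + \<epsilon>))))"
      unfolding exp_diff[symmetric] by (simp add: algebra_simps)
    finally show ?thesis using rate by simp
  qed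
  moreover have "S_B 0 g n (z / (1 - \<epsilon>)) \<le> \<eta>"
  \<comment> \<open>If the perturbed estimate reaches 1, \<open>S_B\<close> takes its default value
    0 and this half of the test passes.\<close>
  proof (cases "z / (1 - \<epsilon>) < 1")
    case True
    let ?q = "z / (1 - \<epsilon>)"
    have q: "0 < ?q" "?q < 1" using z eps True by auto
    have pos: "0 \<le> 1 + - \<epsilon> * ?q" using q eps mult_le_one[of \<epsilon> ?q] by simp
    have "S_B 0 g n ?q = 1 - binomial_tail ?q n (Suc g)" by (rule S_B_lower[OF q g(2)])
    also have "\<dots> \<le> (1 + - \<epsilon> * ?q) ^ n / (1 - \<epsilon>) ^ g"
      using binomial_tail_compl_le_chernoff[of ?q "1 - \<epsilon>" n g] q eps by simp
    also have "\<dots> \<le> exp (real n * (- \<epsilon> * ?q)) / (1 - \<epsilon>) ^ g"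
      using pos eps by (intro divide_right_mono power_le_exp_mult) auto
    also have "real n * (- \<epsilon> * ?q) = - (real g * (\<epsilon> / (1 - \<epsilon>)))"
      using n by (simp add: z_def)
    also have "(1 - \<epsilon>) ^ g = exp (real g * ln (1 - \<epsilon>))"
      using eps by (simp add: exp_of_nat_mult)
    also have "exp (- (real g * (\<epsilon> / (1 - \<epsilon>)))) / exp (real g * ln (1 - \<epsilon>))
        = exp (- (real g * (\<epsilon> / (1 - \<epsilon>) + ln (1 - \<epsilon>))))"
      unfolding exp_diff[symmetric] by (simp add: algebra_simps)
    also have "\<dots> \<le> exp (- (real g * (ln (1 + \<epsilon>) - \<epsilon> / (1 + \<epsilon>))))"
      using ln_ratio_bound[of \<epsilon>] eps by (simp add: mult_left_mono)
    finally show ?thesis using rate by simp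
  qed (use eta in \<open>simp add: S_B_def\<close>)
  ultimately show ?thesis by (simp add: stopping_test_def z_def)
qed

text \<open>A miss puts \<open>p\<close> on the far side of a perturbed estimate, where monotonicity
  makes the relevant tail at \<open>p\<close> no larger than the tested one. In both cases the
  perturbed estimate lies strictly between 0 and 1, so the default value of \<open>S_B\<close>
  cannot be what passed the test.\<close>

lemma stopping_test_misses:
  assumes eps: "0 < \<epsilon>" "\<epsilon> < 1" and p: "0 < p" "p < 1" and g: "1 \<le> g" "g \<le> n"
    and test: "stopping_test \<epsilon> \<eta> g n"
    and miss: "\<not> \<bar>(real g / real n - p) / p\<bar> < \<epsilon>"
  shows "binomial_tail p n g \<le> \<eta> \<or> 1 - binomial_tail p n (Suc g) \<le> \<eta>"
proof -
  define z where "z = real g / real n"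
  have z: "0 < z" "z \<le> 1" using g by (auto simp: z_def)
  have S: "S_B g n n (z / (1 + \<epsilon>)) \<le> \<eta>" "S_B 0 g n (z / (1 - \<epsilon>)) \<le> \<eta>"
    using test by (auto simp: stopping_test_def z_def Let_def)
  have "\<epsilon> * p \<le> \<bar>z - p\<bar>"
    using miss p by (simp add: z_def[symmetric] abs_divide not_less pos_le_divide_eq)
  then consider "(1 + \<epsilon>) * p \<le> z" | "z \<le> (1 - \<epsilon>) * p"
    by (auto simp: abs_if algebra_simps split: if_splits)
  then show ?thesis
  proof cases
    case 1
    then have q: "p \<le> z / (1 + \<epsilon>)" "z / (1 + \<epsilon>) < 1"
      using eps z by (auto simp: field_simps)
    then have "binomial_tail p n g \<le> binomial_tail (z / (1 + \<epsilon>)) n g"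
      using p by (intro binomial_tail_mono_prob) auto
    also have "\<dots> = S_B g n n (z / (1 + \<epsilon>))" using p q by (intro S_B_upper[symmetric]) auto
    finally show ?thesis using S by simp
  next
    case 2
    then have q: "0 < z / (1 - \<epsilon>)" "z / (1 - \<epsilon>) \<le> p"
      using eps z by (auto simp: field_simps)
    then have "1 - binomial_tail p n (Suc g) \<le> 1 - binomial_tail (z / (1 - \<epsilon>)) n (Suc g)"
      using p by (intro diff_left_mono binomial_tail_mono_prob) auto
    also have "\<dots> = S_B 0 g n (z / (1 - \<epsilon>))" using p q g by (intro S_B_lower[symmetric]) auto
    finally show ?thesis using S by simp
  qed
qed

section \<open>Inverse sampling along a single outcome\<close>

text \<open>A nonempty set of naturals attains its infimum, and the empty one gives \<infinity>. The
  right-hand side involves only countably many partial sums, which yields measurability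
  later.\<close>

lemma inv_sample_number_eq_enat_iff:
  "inv_sample_number X g \<omega> = enat n \<longleftrightarrow>
     (\<Sum>i=1..n. X i \<omega>) = real g \<and> (\<forall>m<n. (\<Sum>i=1..m. X i \<omega>) \<noteq> real g)"
proof -
  define A where "A = {n. (\<Sum>i=1..n. X i \<omega>) = real g}"
  have inv: "inv_sample_number X g \<omega> = (INF n\<in>A. enat n)"
    by (simp add: inv_sample_number_def A_def)
  show ?thesis
  proof (cases "A = {}")
    case True
    then show ?thesis unfolding inv by (auto simp: A_def top_enat_def)
  next
    case False
    define k where "k = (LEAST n. n \<in> A)"
    have k: "k \<in> A" "\<And>m. m \<in> A \<Longrightarrow> k \<le> m"
      using False by (auto simp: k_def intro: LeastI Least_le)
    have "inv_sample_number X g \<omega> = enat k"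
      unfolding inv using k by (intro antisym INF_greatest INF_lower) auto
    moreover have "k = n \<longleftrightarrow> n \<in> A \<and> (\<forall>m<n. m \<notin> A)"
      using k by (meson linorder_neqE_nat not_le)
    ultimately show ?thesis by (simp add: A_def)
  qed
qed

text \<open>Replaces \<open>LEAST\<close> and \<open>the_enat\<close> by countable quantifiers. The
  predicate is arbitrary so that the same equivalence serves both the coverage event and a miss
  after termination.\<close>

lemma terminates_and_p_hat_iff:
  "terminates \<epsilon> \<eta> s \<gamma> X \<omega> \<and> P (p_hat \<epsilon> \<eta> s \<gamma> X \<omega>) \<longleftrightarrow>
     (\<exists>l\<in>{1..s}. \<exists>n. inv_sample_number X (\<gamma> l) \<omega> = enat n \<and> stopping_test \<epsilon> \<eta> (\<gamma> l) n \<and>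
        (\<forall>k\<in>{1..<l}. \<not> stops_at \<epsilon> \<eta> \<gamma> X \<omega> k) \<and> P ((\<Sum>i=1..n. X i \<omega>) / real n))"
    (is "?L \<longleftrightarrow> ?R")
proof
  let ?Q = "\<lambda>l. l \<in> {1..s} \<and> stops_at \<epsilon> \<eta> \<gamma> X \<omega> l"
  {
    assume L: ?L
    then have ex: "\<exists>l. ?Q l" by (auto simp: terminates_def)
    define l where "l = stopping_stage \<epsilon> \<eta> s \<gamma> X \<omega>"
    have l: "l = (LEAST l. ?Q l)" by (simp add: l_def stopping_stage_def)
    have Q: "?Q l" unfolding l using ex by (rule LeastI_ex)
    have least: "\<not> stops_at \<epsilon> \<eta> \<gamma> X \<omega> k" if "k \<in> {1..<l}" for k
      using not_less_Least[of k ?Q] that Q unfolding l[symmetric] by auto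
    obtain n where "inv_sample_number X (\<gamma> l) \<omega> = enat n" "stopping_test \<epsilon> \<eta> (\<gamma> l) n"
      using Q by (auto simp: stops_at_def)
    moreover from this have "p_hat \<epsilon> \<eta> s \<gamma> X \<omega> = (\<Sum>i=1..n. X i \<omega>) / real n"
      by (simp add: p_hat_def sample_size_def l_def)
    ultimately show ?R using L Q least by (intro bexI[of _ l] exI[of _ n]) auto
  next
    assume ?R
    then obtain l n where l: "l \<in> {1..s}" "inv_sample_number X (\<gamma> l) \<omega> = enat n"
        "stopping_test \<epsilon> \<eta> (\<gamma> l) n" "\<forall>k\<in>{1..<l}. \<not> stops_at \<epsilon> \<eta> \<gamma> X \<omega> k"
        "P ((\<Sum>i=1..n. X i \<omega>) / real n)" by blast
    then have Q: "?Q l" by (auto simp: stops_at_def)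
    have "stopping_stage \<epsilon> \<eta> s \<gamma> X \<omega> = l"
      unfolding stopping_stage_def using Q l(4) by (intro Least_equality) (auto simp: not_less[symmetric])
    then have "p_hat \<epsilon> \<eta> s \<gamma> X \<omega> = (\<Sum>i=1..n. X i \<omega>) / real n"
      using l(2) by (simp add: p_hat_def sample_size_def)
    then show ?L using Q l(5) by (auto simp: terminates_def)
  }
qed

text \<open>Partial sums move by 0 or 1, so they skip no integer.\<close>

lemma sum_binary_attains:
  fixes x :: "nat \<Rightarrow> real"
  assumes "\<And>i. 1 \<le> i \<Longrightarrow> x i = 0 \<or> x i = 1" and "real g \<le> (\<Sum>i=1..n. x i)"
  shows "\<exists>m\<le>n. (\<Sum>i=1..m. x i) = real g"
  using assms(2)
proof (induction n)
  case (Suc n)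
  show ?case
  proof (cases "real g \<le> (\<Sum>i=1..n. x i)")
    case True
    then show ?thesis using Suc.IH by (meson le_SucI)
  next
    case False
    \<comment> \<open>Integrality turns a sum below \<open>g\<close> into one of at most
      \<open>g - 1\<close>, so the next step must land exactly on \<open>g\<close>.\<close>
    have "\<exists>k. (\<Sum>i=1..n. x i) = real k"
    proof (induction n)
      case (Suc n)
      then obtain k where "(\<Sum>i=1..n. x i) = real k" by blast
      then have "(\<Sum>i=1..Suc n. x i) = real (k + (if x (Suc n) = 1 then 1 else 0))"
        using assms(1)[of "Suc n"] by auto
      then show ?case by blast
    qed simp
    then obtain k where k: "(\<Sum>i=1..n. x i) = real k" by blast
    have "(\<Sum>i=1..Suc n. x i) = real k + x (Suc n)" by (simp flip: k)
    then have "(\<Sum>i=1..Suc n. x i) = real g"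
      using assms(1)[of "Suc n"] False Suc.prems k by auto
    then show ?thesis by blast
  qed
qed simp

lemma sum_binary_mono:
  fixes x :: "nat \<Rightarrow> real"
  assumes "\<And>i. 1 \<le> i \<Longrightarrow> x i = 0 \<or> x i = 1" and "m \<le> n"
  shows "(\<Sum>i=1..m. x i) \<le> (\<Sum>i=1..n. x i)"
proof (rule sum_mono2)
  show "0 \<le> x i" if "i \<in> {1..n} - {1..m}" for i using assms(1)[of i] that by auto
qed (use assms in auto)

lemma sum_binary_le:
  fixes x :: "nat \<Rightarrow> real"
  assumes "\<And>i. 1 \<le> i \<Longrightarrow> x i = 0 \<or> x i = 1"
  shows "(\<Sum>i=1..n. x i) \<le> real n"
proof -
  have "(\<Sum>i=1..n. x i) \<le> (\<Sum>i=1..n. 1)"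
    using assms by (intro sum_mono) force
  then show ?thesis by simp
qed

subsection \<open>Inverse sampling of a Bernoulli sequence\<close>

text \<open>The two point probabilities add up to 1, so the values are binary only almost surely;
  pathwise facts therefore appear under \<open>AE\<close>.\<close>

locale bernoulli_sequence = prob_space M for M :: "'a measure" +
  fixes X :: "nat \<Rightarrow> 'a \<Rightarrow> real" and p :: real
  assumes p: "0 < p" "p < 1"
    and indep: "indep_vars (\<lambda>_. borel) X {1..}"
    and prob_1: "\<And>i. 1 \<le> i \<Longrightarrow> prob {\<omega> \<in> space M. X i \<omega> = 1} = p"
    and prob_0: "\<And>i. 1 \<le> i \<Longrightarrow> prob {\<omega> \<in> space M. X i \<omega> = 0} = 1 - p"
begin

abbreviation psum :: "nat \<Rightarrow> 'a \<Rightarrow> real" where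
  "psum n \<omega> \<equiv> (\<Sum>i=1..n. X i \<omega>)"

lemma X_measurable: "1 \<le> i \<Longrightarrow> X i \<in> borel_measurable M"
  using indep by (auto simp: indep_vars_def)

lemma psum_measurable [measurable]: "psum n \<in> borel_measurable M"
  by (intro borel_measurable_sum X_measurable) auto

lemma AE_binary: "AE \<omega> in M. \<forall>i\<ge>1. X i \<omega> = 0 \<or> X i \<omega> = 1"
proof -
  have "AE \<omega> in M. 1 \<le> i \<longrightarrow> X i \<omega> = 0 \<or> X i \<omega> = 1" for i
  proof (cases "1 \<le> i")
    case True
    note [measurable] = X_measurable[OF True]
    have "prob ({\<omega> \<in> space M. X i \<omega> = 0} \<union> {\<omega> \<in> space M. X i \<omega> = 1}) = (1 - p) + p"
      by (subst finite_measure_Union) (auto simp: prob_0[OF True] prob_1[OF True])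
    then have "AE \<omega> in M. \<omega> \<in> {\<omega> \<in> space M. X i \<omega> = 0} \<union> {\<omega> \<in> space M. X i \<omega> = 1}"
      by (intro AE_prob_1) simp
    then show ?thesis by eventually_elim auto
  qed simp
  then show ?thesis by (simp add: AE_all_countable)
qed

lemma prob_X_psum:
  assumes "A \<in> sets borel" "B \<in> sets borel"
  shows "prob {\<omega> \<in> space M. X (Suc n) \<omega> \<in> A \<and> psum n \<omega> \<in> B} =
    prob {\<omega> \<in> space M. X (Suc n) \<omega> \<in> A} * prob {\<omega> \<in> space M. psum n \<omega> \<in> B}"
proof -
  have "indep_vars (\<lambda>_. borel) X (insert (Suc n) {1..n})"
    using indep by (rule indep_vars_subset) auto
  then have "indep_var borel (X (Suc n)) borel (psum n)"
    by (intro indep_vars_sum) auto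
  from indep_varD[OF this assms] show ?thesis
    by (simp add: vimage_def Int_def conj_commute)
qed

text \<open>Splitting on the last variable, which is independent of the earlier sum, reproduces the
  recursion of \<open>binomial_tail\<close>.\<close>

lemma prob_psum_ge: "prob {\<omega> \<in> space M. real k \<le> psum n \<omega>} = binomial_tail p n k"
proof (induction n arbitrary: k)
  case 0
  then show ?case by (cases k) (auto simp: prob_space)
next
  case (Suc n)
  note [measurable] = X_measurable[of "Suc n", simplified]
  show ?case
  proof (cases k)
    case 0
    have "AE \<omega> in M. 0 \<le> psum (Suc n) \<omega>"
      using AE_binary by eventually_elim (force intro!: sum_nonneg)
    then show ?thesis
      using psum_measurable[of "Suc n"] by (simp add: 0 prob_eq_1 del: sum.cl_ivl_Suc One_nat_def)
  next
    case (Suc j)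
    let ?A = "{\<omega> \<in> space M. X (Suc n) \<omega> \<in> {1} \<and> psum n \<omega> \<in> {real j..}}"
    let ?B = "{\<omega> \<in> space M. X (Suc n) \<omega> \<in> {0} \<and> psum n \<omega> \<in> {real (Suc j)..}}"
    \<comment> \<open>Outcomes with a non-binary last value may violate the decomposition; they form
      a null set.\<close>
    have "prob {\<omega> \<in> space M. real (Suc j) \<le> psum (Suc n) \<omega>} = prob (?A \<union> ?B)"
    proof (rule finite_measure_eq_AE)
      show "AE \<omega> in M. \<omega> \<in> {\<omega> \<in> space M. real (Suc j) \<le> psum (Suc n) \<omega>} \<longleftrightarrow> \<omega> \<in> ?A \<union> ?B"
        using AE_binary
      proof eventually_elim
        case (elim \<omega>)
        then have "X (Suc n) \<omega> = 0 \<or> X (Suc n) \<omega> = 1" by simp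
        then show ?case by auto
      qed
    qed measurable
    also have "\<dots> = prob ?A + prob ?B"
      by (rule finite_measure_Union) (measurable, auto)
    also have "prob ?A = p * binomial_tail p n j"
      using prob_X_psum[of "{1}" "{real j..}" n] prob_1[of "Suc n"] Suc.IH[of j] by simp
    also have "prob ?B = (1 - p) * binomial_tail p n (Suc j)"
      using prob_X_psum[of "{0}" "{real (Suc j)..}" n] prob_0[of "Suc n"] Suc.IH[of "Suc j"] by simp
    finally show ?thesis using Suc by (simp add: binomial_tail_Suc_Suc)
  qed
qed

lemma prob_psum_less: "prob {\<omega> \<in> space M. \<not> real k \<le> psum n \<omega>} = 1 - binomial_tail p n k"
  using prob_neg[of "\<lambda>\<omega>. real k \<le> psum n \<omega>"] prob_psum_ge[of k n] by (simp del: One_nat_def)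

text \<open>Never reaching \<open>k\<close> implies being below \<open>k\<close> after n samples,
  for every n, and the probability of the latter tends to 0.\<close>

lemma AE_psum_unbounded: "AE \<omega> in M. \<exists>n. real k \<le> psum n \<omega>"
proof -
  let ?Z = "{\<omega> \<in> space M. \<not> (\<exists>n. real k \<le> psum n \<omega>)}"
  have "(\<lambda>n. 1 - binomial_tail p n k) \<longlonglongrightarrow> 1 - 1"
    using p by (intro tendsto_intros binomial_tail_tendsto_1)
  moreover have "prob ?Z \<le> 1 - binomial_tail p n k" for n
    unfolding prob_psum_less[symmetric] by (intro finite_measure_mono) (auto simp del: One_nat_def)
  ultimately have "prob ?Z \<le> 1 - 1" by (intro LIMSEQ_le_const) auto
  then have "prob ?Z = 0" by (simp add: measure_le_0_iff)
  then show ?thesis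
    by (subst AE_iff_measurable[OF _ refl]) (auto simp: emeasure_eq_measure simp del: One_nat_def)
qed

lemma AE_inv_sample_number_finite: "AE \<omega> in M. \<exists>n. inv_sample_number X g \<omega> = enat n"
  using AE_binary AE_psum_unbounded[of g]
proof eventually_elim
  case (elim \<omega>)
  then have "\<exists>m. psum m \<omega> = real g"
    using sum_binary_attains[of "\<lambda>i. X i \<omega>" g] by blast
  then show ?case unfolding inv_sample_number_eq_enat_iff
    using exists_least_iff[of "\<lambda>m. psum m \<omega> = real g"] by blast
qed

text \<open>The test \<open>binomial_tail p n g \<le> \<eta>\<close> can only hold for \<open>n\<close> up to some \<open>m\<close>, and passing it means that
  \<open>g\<close> is reached within \<open>m\<close> samples.\<close>

lemma overestimation_event:
  assumes "\<eta> < 1" "0 \<le> \<eta>"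
  shows "\<exists>E\<in>events. prob E \<le> \<eta> \<and>
    (AE \<omega> in M. \<forall>n. inv_sample_number X g \<omega> = enat n \<and> binomial_tail p n g \<le> \<eta> \<longrightarrow> \<omega> \<in> E)"
proof -
  define A where "A = {n. binomial_tail p n g \<le> \<eta>}"
  \<comment> \<open>The tails tend to 1, which exceeds \<eta>, so only finitely many sample sizes
    qualify.\<close>
  have "eventually (\<lambda>n. \<eta> < binomial_tail p n g) sequentially"
    using binomial_tail_tendsto_1[OF p, of g] assms(1) by (rule order_tendstoD)
  then have fin: "finite A"
    by (simp add: A_def cofinite_eq_sequentially[symmetric] eventually_cofinite not_less)
  show ?thesis
  proof (cases "A = {}")
    case True
    then show ?thesis using assms(2) by (intro bexI[of _ "{}"]) (auto simp: A_def)
  next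
    case False
    define m where "m = Max A"
    let ?E = "{\<omega> \<in> space M. real g \<le> psum m \<omega>}"
    have "m \<in> A" using fin False by (simp add: m_def)
    then have "prob ?E \<le> \<eta>" by (simp add: prob_psum_ge A_def del: One_nat_def)
    moreover have "AE \<omega> in M. \<forall>n. inv_sample_number X g \<omega> = enat n \<and> binomial_tail p n g \<le> \<eta> \<longrightarrow> \<omega> \<in> ?E"
      using AE_binary AE_space
    proof eventually_elim
      case (elim \<omega>)
      show ?case
      proof (intro allI impI)
        fix n
        assume n: "inv_sample_number X g \<omega> = enat n \<and> binomial_tail p n g \<le> \<eta>"
        then have "n \<le> m" using fin by (simp add: m_def A_def)
        then have "psum n \<omega> \<le> psum m \<omega>" using elim by (intro sum_binary_mono) auto
        then show "\<omega> \<in> ?E" using n elim by (simp add: inv_sample_number_eq_enat_iff)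
      qed
    qed
    ultimately show ?thesis by (intro bexI[of _ ?E] conjI) measurable
  qed
qed

text \<open>Mirror image of the previous lemma: with m the least sample size satisfying the
  lower-tail condition, satisfying it means that \<open>g\<close> was not reached within
  \<open>m - 1\<close> samples.\<close>

lemma underestimation_event:
  assumes "\<eta> < 1" "0 \<le> \<eta>"
  shows "\<exists>E\<in>events. prob E \<le> \<eta> \<and>
    (AE \<omega> in M. \<forall>n. inv_sample_number X g \<omega> = enat n \<and> 1 - binomial_tail p n (Suc g) \<le> \<eta> \<longrightarrow> \<omega> \<in> E)"
proof (cases "\<exists>n. 1 - binomial_tail p n (Suc g) \<le> \<eta>")
  case False
  then show ?thesis using assms(2) by (intro bexI[of _ "{}"]) auto
next
  case True
  then obtain m where m: "1 - binomial_tail p m (Suc g) \<le> \<eta>"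
    and least: "\<And>n. 1 - binomial_tail p n (Suc g) \<le> \<eta> \<Longrightarrow> m \<le> n"
    using exists_least_iff[of "\<lambda>n. 1 - binomial_tail p n (Suc g) \<le> \<eta>"] by (meson not_less)
  \<comment> \<open>With no samples the lower tail is 1, which exceeds \<eta>.\<close>
  have "m \<noteq> 0" using m assms(1) by (intro notI) simp
  then obtain j where j: "m = Suc j" by (cases m) auto
  let ?E = "{\<omega> \<in> space M. \<not> real g \<le> psum j \<omega>}"
  \<comment> \<open>Fewer than \<open>g\<close> successes in j trials force at most \<open>g\<close>
    in \<open>j + 1\<close> trials, which matches the condition at \<open>m = Suc j\<close>.\<close>
  have "prob ?E \<le> \<eta>"
    using binomial_tail_Suc_Suc_le[of p j g] p m j by (simp add: prob_psum_less del: One_nat_def)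
  moreover have "AE \<omega> in M. \<forall>n. inv_sample_number X g \<omega> = enat n \<and> 1 - binomial_tail p n (Suc g) \<le> \<eta> \<longrightarrow> \<omega> \<in> ?E"
    using AE_binary AE_space
  proof eventually_elim
    case (elim \<omega>)
    show ?case
    proof (intro allI impI)
      fix n
      assume n: "inv_sample_number X g \<omega> = enat n \<and> 1 - binomial_tail p n (Suc g) \<le> \<eta>"
      then have "j < n" using least[of n] j by simp
      have "\<not> real g \<le> psum j \<omega>"
      proof
        assume "real g \<le> psum j \<omega>"
        then obtain i where "i \<le> j" "psum i \<omega> = real g"
          using sum_binary_attains[of "\<lambda>i. X i \<omega>" g j] elim by auto
        then show False using n \<open>j < n\<close> by (auto simp: inv_sample_number_eq_enat_iff)
      qed
      then show "\<omega> \<in> ?E" using elim by simp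
    qed
  qed
  ultimately show ?thesis by (intro bexI[of _ ?E] conjI) measurable
qed

section \<open>Measurability and the union bound over stages\<close>

lemma stops_at_measurable [measurable]: "Measurable.pred M (\<lambda>\<omega>. stops_at \<epsilon> \<eta> \<gamma> X \<omega> l)"
  unfolding stops_at_def inv_sample_number_eq_enat_iff by measurable

lemma coverage_event_measurable:
  "{\<omega> \<in> space M. terminates \<epsilon> \<eta> s \<gamma> X \<omega> \<and> \<bar>(p_hat \<epsilon> \<eta> s \<gamma> X \<omega> - p) / p\<bar> < \<epsilon>} \<in> events"
  unfolding terminates_and_p_hat_iff[where P="\<lambda>x. \<bar>(x - p) / p\<bar> < \<epsilon>"] inv_sample_number_eq_enat_iff
  by measurable

text \<open>Each stage contributes two exceptional events of probability at most \<eta>. Stage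
  \<open>t\<close> has a threshold so large that it passes whenever it is reached, so almost surely
  failure can only be a miss, and a miss lies in an exceptional event of its stage.\<close>

lemma coverage_probability:
  assumes eps: "0 < \<epsilon>" "\<epsilon> < 1" and eta: "0 < \<eta>" "\<eta> < 1"
    and pos: "\<And>l. l \<in> {1..s} \<Longrightarrow> 1 \<le> \<gamma> l"
    and last: "t \<in> {1..s}" "ln (1 / \<eta>) \<le> real (\<gamma> t) * (ln (1 + \<epsilon>) - \<epsilon> / (1 + \<epsilon>))"
  shows "1 - 2 * real s * \<eta> \<le>
    prob {\<omega> \<in> space M. terminates \<epsilon> \<eta> s \<gamma> X \<omega> \<and> \<bar>(p_hat \<epsilon> \<eta> s \<gamma> X \<omega> - p) / p\<bar> < \<epsilon>}"
    (is "_ \<le> prob ?G")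
proof -
  \<comment> \<open>The events are chosen per stage before any outcome is fixed, so the countably
    many null sets can be merged.\<close>
  have "\<forall>l. \<exists>E. E \<in> events \<and> prob E \<le> \<eta> \<and> (AE \<omega> in M. \<forall>n.
      inv_sample_number X (\<gamma> l) \<omega> = enat n \<and> binomial_tail p n (\<gamma> l) \<le> \<eta> \<longrightarrow> \<omega> \<in> E)"
    using overestimation_event[OF eta(2) less_imp_le[OF eta(1)]] by blast
  from choice[OF this] obtain E where "\<forall>l. E l \<in> events \<and> prob (E l) \<le> \<eta> \<and> (AE \<omega> in M. \<forall>n.
      inv_sample_number X (\<gamma> l) \<omega> = enat n \<and> binomial_tail p n (\<gamma> l) \<le> \<eta> \<longrightarrow> \<omega> \<in> E l)" ..
  then have E: "E l \<in> events" "prob (E l) \<le> \<eta>" "AE \<omega> in M. \<forall>n.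
      inv_sample_number X (\<gamma> l) \<omega> = enat n \<and> binomial_tail p n (\<gamma> l) \<le> \<eta> \<longrightarrow> \<omega> \<in> E l" for l
    by simp_all
  have "\<forall>l. \<exists>E. E \<in> events \<and> prob E \<le> \<eta> \<and> (AE \<omega> in M. \<forall>n.
      inv_sample_number X (\<gamma> l) \<omega> = enat n \<and> 1 - binomial_tail p n (Suc (\<gamma> l)) \<le> \<eta> \<longrightarrow> \<omega> \<in> E)"
    using underestimation_event[OF eta(2) less_imp_le[OF eta(1)]] by blast
  from choice[OF this] obtain F where "\<forall>l. F l \<in> events \<and> prob (F l) \<le> \<eta> \<and> (AE \<omega> in M. \<forall>n.
      inv_sample_number X (\<gamma> l) \<omega> = enat n \<and> 1 - binomial_tail p n (Suc (\<gamma> l)) \<le> \<eta> \<longrightarrow> \<omega> \<in> F l)" ..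
  then have F: "F l \<in> events" "prob (F l) \<le> \<eta>" "AE \<omega> in M. \<forall>n.
      inv_sample_number X (\<gamma> l) \<omega> = enat n \<and> 1 - binomial_tail p n (Suc (\<gamma> l)) \<le> \<eta> \<longrightarrow> \<omega> \<in> F l" for l
    by simp_all
  have AE_E: "AE \<omega> in M. \<forall>l n.
      inv_sample_number X (\<gamma> l) \<omega> = enat n \<and> binomial_tail p n (\<gamma> l) \<le> \<eta> \<longrightarrow> \<omega> \<in> E l"
    using E(3) by (subst AE_all_countable) blast
  have AE_F: "AE \<omega> in M. \<forall>l n.
      inv_sample_number X (\<gamma> l) \<omega> = enat n \<and> 1 - binomial_tail p n (Suc (\<gamma> l)) \<le> \<eta> \<longrightarrow> \<omega> \<in> F l"
    using F(3) by (subst AE_all_countable) blast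
  let ?B = "\<Union>l\<in>{1..s}. E l \<union> F l"
  have "AE \<omega> in M. \<omega> \<in> space M - ?G \<longrightarrow> \<omega> \<in> ?B"
    using AE_binary AE_inv_sample_number_finite[of "\<gamma> t"] AE_E AE_F
  proof eventually_elim
    case (elim \<omega>)
    \<comment> \<open>Binary values need at least as many samples as successes; both lemmas on the
      stopping test require this.\<close>
    have le: "\<gamma> l \<le> n" if "inv_sample_number X (\<gamma> l) \<omega> = enat n" for l n
      using that elim(1) sum_binary_le[of "\<lambda>i. X i \<omega>" n] by (simp add: inv_sample_number_eq_enat_iff)
    show ?case
    proof
      assume \<omega>: "\<omega> \<in> space M - ?G"
      obtain n where n: "inv_sample_number X (\<gamma> t) \<omega> = enat n" using elim(2) by blast
      have "stopping_test \<epsilon> \<eta> (\<gamma> t) n"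
        using eps eta(1) pos[OF last(1)] le[OF n] last(2) by (rule stopping_test_large_threshold)
      then have "terminates \<epsilon> \<eta> s \<gamma> X \<omega>"
        using n last(1) by (auto simp: terminates_def stops_at_def)
      with \<omega> have "terminates \<epsilon> \<eta> s \<gamma> X \<omega> \<and> \<not> \<bar>(p_hat \<epsilon> \<eta> s \<gamma> X \<omega> - p) / p\<bar> < \<epsilon>" by auto
      then obtain l k where l: "l \<in> {1..s}" and k: "inv_sample_number X (\<gamma> l) \<omega> = enat k"
        and test: "stopping_test \<epsilon> \<eta> (\<gamma> l) k"
        and miss: "\<not> \<bar>(psum k \<omega> / real k - p) / p\<bar> < \<epsilon>"
        unfolding terminates_and_p_hat_iff[where P="\<lambda>x. \<not> \<bar>(x - p) / p\<bar> < \<epsilon>"] by blast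
      have "psum k \<omega> = real (\<gamma> l)" using k by (simp add: inv_sample_number_eq_enat_iff)
      then have "binomial_tail p k (\<gamma> l) \<le> \<eta> \<or> 1 - binomial_tail p k (Suc (\<gamma> l)) \<le> \<eta>"
        using stopping_test_misses[OF eps p pos[OF l] le[OF k] test] miss by simp
      then show "\<omega> \<in> ?B" using l k elim(3,4) by blast
    qed
  qed
  then have "prob (space M - ?G) \<le> prob ?B"
    using E(1) F(1) by (intro finite_measure_mono_AE) auto
  also have "\<dots> \<le> (\<Sum>l\<in>{1..s}. prob (E l \<union> F l))"
    using E(1) F(1) by (intro finite_measure_subadditive_finite) auto
  also have "\<dots> \<le> (\<Sum>l\<in>{1..s}. 2 * \<eta>)"
  proof (rule sum_mono)
    fix l
    show "prob (E l \<union> F l) \<le> 2 * \<eta>"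
      using measure_Un_le[OF E(1) F(1), of l l] E(2)[of l] F(2)[of l] by linarith
  qed
  finally show ?thesis
    using prob_compl[OF coverage_event_measurable[of \<epsilon> \<eta> s \<gamma>]] by simp
qed

end

section \<open>Coverage for the prescribed thresholds\<close>

theorem theorem2:
  fixes \<epsilon> \<delta> \<zeta> \<rho> \<nu> p :: real
    and \<tau> s :: nat
    and \<gamma> :: "nat \<Rightarrow> nat"
    and M :: "'a measure"
    and X :: "nat \<Rightarrow> 'a \<Rightarrow> real"
  assumes "0 < \<epsilon>" "\<epsilon> < 1"
    and "0 < \<delta>" "\<delta> < 1"
    and "0 < \<zeta>"
    and "0 < \<rho>"
    and \<nu>: "\<nu> = \<epsilon> / ((1 + \<epsilon>) * ln (1 + \<epsilon>) - \<epsilon>)"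
    and \<tau>: "\<tau> = nat \<lceil>ln (1 + \<nu>) / ln (1 + \<rho>)\<rceil>"
    and \<gamma>_mono: "strict_mono_on {1..s} \<gamma>"
    and \<gamma>_elems: "\<gamma> ` {1..s} =
      (\<lambda>i::nat. nat \<lceil>(1 + \<nu>) powr (real i / real \<tau>) * (ln (1 / (\<zeta> * \<delta>)) / ln (1 + \<epsilon>))\<rceil>) ` {0..\<tau>}"
    and "0 < p" "p < 1"
    and "prob_space M"
    and indep: "prob_space.indep_vars M (\<lambda>_. borel) X {1..}"
    and bernoulli1: "\<And>i. 1 \<le> i \<Longrightarrow> measure M {\<omega> \<in> space M. X i \<omega> = 1} = p"
    and bernoulli0: "\<And>i. 1 \<le> i \<Longrightarrow> measure M {\<omega> \<in> space M. X i \<omega> = 0} = 1 - p"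
    and \<zeta>: "\<zeta> \<le> 1 / (2 * (real \<tau> + 1))"
  shows "measure M {\<omega> \<in> space M. terminates \<epsilon> (\<zeta> * \<delta>) s \<gamma> X \<omega> \<and>
           \<bar>(p_hat \<epsilon> (\<zeta> * \<delta>) s \<gamma> X \<omega> - p) / p\<bar> < \<epsilon>} \<ge> 1 - \<delta>"
proof -
  interpret prob_space M by fact
  interpret bernoulli_sequence M X p
    using \<open>0 < p\<close> \<open>p < 1\<close> indep bernoulli1 bernoulli0 by unfold_locales
  define \<eta> where "\<eta> = \<zeta> * \<delta>"
  define L where "L = ln (1 / \<eta>) / ln (1 + \<epsilon>)"
  define f where "f i = nat \<lceil>(1 + \<nu>) powr (real i / real \<tau>) * L\<rceil>" for i :: nat
  have \<gamma>_image: "\<gamma> ` {1..s} = f ` {0..\<tau>}"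
    using \<gamma>_elems by (simp add: f_def[abs_def] L_def \<eta>_def)
  have \<nu>_pos: "0 < \<nu>" using \<nu> chernoff_rate_pos[of \<epsilon>] \<open>0 < \<epsilon>\<close> by simp
  \<comment> \<open>Needed for \<open>real \<tau> / real \<tau>\<close> to be 1; division by zero
    would give exponent 0.\<close>
  have "\<tau> \<noteq> 0"
  proof -
    have "0 < ln (1 + \<nu>) / ln (1 + \<rho>)" using \<nu>_pos \<open>0 < \<rho>\<close> by simp
    then show ?thesis unfolding \<tau> by linarith
  qed
  \<comment> \<open>The bound on \<zeta> is at most 1/2. Then \<open>\<eta> < 1\<close>, so
    \<open>L\<close> and all thresholds are positive.\<close>
  have "\<zeta> < 1"
    using \<zeta> by (rule order.strict_trans1) (simp add: field_simps add_strict_increasing)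
  have \<eta>: "0 < \<eta>" "\<eta> < 1"
    using \<open>0 < \<zeta>\<close> \<open>\<zeta> < 1\<close> \<open>0 < \<delta>\<close> \<open>\<delta> < 1\<close> mult_strict_mono[of \<zeta> 1 \<delta> 1] by (auto simp: \<eta>_def)
  have "0 < L" using \<eta> \<open>0 < \<epsilon>\<close> by (simp add: L_def)
  have "1 \<le> f i" for i
  proof -
    have "0 < (1 + \<nu>) powr (real i / real \<tau>) * L" using \<nu>_pos \<open>0 < L\<close> by simp
    then show ?thesis unfolding f_def by linarith
  qed
  then have \<gamma>_pos: "1 \<le> \<gamma> l" if "l \<in> {1..s}" for l
    using imageI[OF that, of \<gamma>] unfolding \<gamma>_image by auto
  have "f \<tau> \<in> \<gamma> ` {1..s}" unfolding \<gamma>_image by simp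
  then obtain t where t: "t \<in> {1..s}" "\<gamma> t = f \<tau>" by auto
  \<comment> \<open>This explains \<nu>: \<open>1 + \<nu>\<close> is
    \<open>ln (1 + \<epsilon>)\<close> divided by the upper-tail exponent per success, so the value
    at \<open>i = \<tau>\<close> before rounding makes the Chernoff bound exactly \<eta>. Rounding
    up only helps.\<close>
  have "ln (1 / \<eta>) = (1 + \<nu>) * L * (ln (1 + \<epsilon>) - \<epsilon> / (1 + \<epsilon>))"
  proof -
    define d where "d = (1 + \<epsilon>) * ln (1 + \<epsilon>) - \<epsilon>"
    have d: "0 < d" using chernoff_rate_pos \<open>0 < \<epsilon>\<close> by (simp add: d_def)
    have "1 + \<nu> = (1 + \<epsilon>) * ln (1 + \<epsilon>) / d"
      using d by (simp add: \<nu> d_def[symmetric] add_divide_eq_iff) (simp add: d_def)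
    moreover have "ln (1 + \<epsilon>) - \<epsilon> / (1 + \<epsilon>) = d / (1 + \<epsilon>)"
      using \<open>0 < \<epsilon>\<close> by (simp add: d_def field_simps)
    ultimately show ?thesis using d \<open>0 < \<epsilon>\<close> by (simp add: L_def)
  qed
  also have "\<dots> \<le> real (f \<tau>) * (ln (1 + \<epsilon>) - \<epsilon> / (1 + \<epsilon>))"
  proof (rule mult_right_mono)
    show "(1 + \<nu>) * L \<le> real (f \<tau>)"
      using \<nu>_pos \<open>\<tau> \<noteq> 0\<close> by (simp add: f_def real_nat_ceiling_ge)
    show "0 \<le> ln (1 + \<epsilon>) - \<epsilon> / (1 + \<epsilon>)"
      using chernoff_rate_pos[of \<epsilon>] \<open>0 < \<epsilon>\<close> by (simp add: field_simps)
  qed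
  finally have "1 - 2 * real s * \<eta> \<le> prob {\<omega> \<in> space M. terminates \<epsilon> \<eta> s \<gamma> X \<omega> \<and>
      \<bar>(p_hat \<epsilon> \<eta> s \<gamma> X \<omega> - p) / p\<bar> < \<epsilon>}"
    using \<open>0 < \<epsilon>\<close> \<open>\<epsilon> < 1\<close> \<eta> \<gamma>_pos t by (intro coverage_probability[where t=t]) auto
  moreover have "2 * real s * \<eta> \<le> \<delta>"
  proof -
    \<comment> \<open>Strict monotonicity makes s the number of distinct thresholds; coinciding
      ceilings can only bring it below \<open>\<tau> + 1\<close>.\<close>
    have "s = card (\<gamma> ` {1..s})"
      using strict_mono_on_imp_inj_on[OF \<gamma>_mono] by (simp add: card_image)
    also have "\<dots> \<le> card {0..\<tau>}" unfolding \<gamma>_image by (rule card_image_le) simp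
    finally have "real s \<le> real \<tau> + 1" by simp
    then have "2 * real s * \<zeta> \<le> 2 * (real \<tau> + 1) * \<zeta>" using \<open>0 < \<zeta>\<close> by simp
    also have "\<dots> \<le> 1" using \<zeta> by (simp add: pos_le_divide_eq mult.commute)
    finally show ?thesis using \<open>0 < \<delta>\<close> mult_right_mono[of _ 1 \<delta>] by (simp add: \<eta>_def mult.assoc[symmetric])
  qed
  ultimately show ?thesis by (simp add: \<eta>_def)
qed

end
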